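(* (Multiple rule) Let $Q$ and $C$ be convex subsets of a real vector space such that $Q\cap C\neq\emptyset$, both $Q$ and $C$ are symmetric with respect to a point $x_0\in Q\cap C$, and $\operatorname{span}(C-x_0)=\operatorname{span}(Q-x_0)$. Let $\mu$ be the Minkowski functional of $C-x_0$ and $\nu$ the Minkowski functional of $Q-x_0$. Let $\varphi:C\to\mathbb{R}$ be a $\mu$-Lipschitz function and $f:Q\to\mathbb{R}$ be a $\nu$-Lipschitz function. Then for all $x\in B_\mu(x_0,1)\cap B_\nu(x_0,1)$, $$\partial^{\mu+\nu}_C(\varphi f)(x)\subset f(x)\,\partial^\mu_C\varphi(x)+\varphi(x)\,\partial^\nu_Cf(x).$$
   Context: A convex set $D$ is symmetric with respect to $x_0\in D$ if $D-x_0=-(D-x_0)$. Put $X_0:=\operatorname{span}(C-x_0)=\operatorname{span}(Q-x_0)$, with algebraic dual $X_0'$. The Minkowski functional of a set $D$ is $\mu_D(v)=\inf\{t>0:v\in tD\}$; $\mu$ and $\nu$ are finite seminorms on $X_0$. For a seminorm $q$ on $X_0$: $B_q(x_0,1):=\{x\in x_0+X_0:q(x-x_0)<1\}$ (so $B_\mu(x_0,1)\subset C$, $B_\nu(x_0,1)\subset Q$); a function $h$ is $q$-Lipschitz on its domain if for some $L>0$, $|h(x)-h(y)|\le Lq(x-y)$ for all $x,y$ in the domain; and the generalized derivative and subdifferential with respect to $q$ are $$h^\circ(x,v):=\limsup_{q(y-x)\to0,\ t\to0+}\frac{h(y+tv)-h(y)}{t},\qquad\partial^q_Ch(x):=\{\zeta\in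 X_0':h^\circ(x,v)\ge\langle\zeta,v\rangle\ \forall v\in X_0\}.$$ These are used with $(h,q)=(\varphi,\mu)$, $(f,\nu)$ and $(\varphi f,\mu+\nu)$, where the pointwise product $\varphi f$ is defined on $Q\cap C$. The subscript $C$ in $\partial_C$ stands for "Clarke". *)

theory Defs
  imports "HOL-Analysis.Analysis"
begin

definition symmetric_about :: "'a::real_vector set \<Rightarrow> 'a \<Rightarrow> bool" where
  "symmetric_about D x0 \<longleftrightarrow>
     x0 \<in> D \<and> (\<lambda>x. x - x0) ` D = uminus ` ((\<lambda>x. x - x0) ` D)"

text \<open>Only used on the span of a convex set that is symmetric about \<open>0\<close>; there the set of
  admissible \<open>t\<close> is nonempty, so the real-valued infimum is the intended one.\<close>

definition minkowski_functional :: "'a::real_vector set \<Rightarrow> 'a \<Rightarrow> real" where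
  "minkowski_functional D v = Inf {t. 0 < t \<and> v \<in> (\<lambda>d. t *\<^sub>R d) ` D}"

text \<open>In the following, \<open>X0\<close> is a linear subspace of the ambient space and \<open>q\<close> a function whose
  values matter only on \<open>X0\<close>, where it is meant to be a seminorm.\<close>

definition seminorm_ball ::
    "'a::real_vector set \<Rightarrow> ('a \<Rightarrow> real) \<Rightarrow> 'a \<Rightarrow> real \<Rightarrow> 'a set" where
  "seminorm_ball X0 q x0 r = {x. x - x0 \<in> X0 \<and> q (x - x0) < r}"

definition seminorm_lipschitz_on ::
    "('a::real_vector \<Rightarrow> real) \<Rightarrow> 'a set \<Rightarrow> ('a \<Rightarrow> real) \<Rightarrow> bool" where
  "seminorm_lipschitz_on q D h \<longleftrightarrow>
     (\<exists>L>0. \<forall>x\<in>D. \<forall>y\<in>D. \<bar>h x - h y\<bar> \<le> L * q (x - y))"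

text \<open>A linear functional on the subspace \<open>X0\<close> is represented by the function that vanishes outside
  \<open>X0\<close>. The representation is unique, and pointwise sums and scalar multiples of representatives
  represent the sums and scalar multiples of the functionals.\<close>

definition algebraic_dual :: "'a::real_vector set \<Rightarrow> ('a \<Rightarrow> real) set" where
  "algebraic_dual X0 = {\<zeta>.
     (\<forall>u\<in>X0. \<forall>v\<in>X0. \<zeta> (u + v) = \<zeta> u + \<zeta> v) \<and>
     (\<forall>c. \<forall>v\<in>X0. \<zeta> (c *\<^sub>R v) = c * \<zeta> v) \<and>
     (\<forall>v. v \<notin> X0 \<longrightarrow> \<zeta> v = 0)}"

text \<open>The limit superior over \<open>q (y - x) \<rightarrow> 0\<close>, \<open>t \<rightarrow> 0+\<close>, where \<open>y\<close> ranges over \<open>x + X0\<close>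
  (\<open>q\<close> is a seminorm on \<open>X0\<close> only) and \<open>y = x\<close> is not excluded. It takes values in the extended
  reals, so no finiteness is presupposed. The function \<open>h\<close> may be defined on a subset only: if some
  \<open>q\<close>-ball around \<open>x\<close> lies in that subset, then \<open>y\<close> and \<open>y + t v\<close> (for \<open>v\<close> in \<open>X0\<close>) eventually
  belong to it, and the values of \<open>h\<close> elsewhere are irrelevant.\<close>

definition clarke_derivative ::
    "'a::real_vector set \<Rightarrow> ('a \<Rightarrow> real) \<Rightarrow> ('a \<Rightarrow> real) \<Rightarrow> 'a \<Rightarrow> 'a \<Rightarrow> ereal" where
  "clarke_derivative X0 q h x v =
     Limsup (inf (filtercomap (\<lambda>y. q (y - x)) (nhds 0)) (principal {y. y - x \<in> X0}) \<times>\<^sub>F at_right 0)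
       (\<lambda>(y, t). ereal ((h (y + t *\<^sub>R v) - h y) / t))"

definition clarke_subdifferential ::
    "'a::real_vector set \<Rightarrow> ('a \<Rightarrow> real) \<Rightarrow> ('a \<Rightarrow> real) \<Rightarrow> 'a \<Rightarrow> ('a \<Rightarrow> real) set" where
  "clarke_subdifferential X0 q h x =
     {\<zeta> \<in> algebraic_dual X0. \<forall>v\<in>X0. clarke_derivative X0 q h x v \<ge> ereal (\<zeta> v)}"

end

theory Submission
  imports Defs
begin

text \<open>Let \<open>a = f x\<close> and \<open>b = \<phi> x\<close>, and let \<open>p\<close>, \<open>r\<close> be the Clarke derivatives of \<open>\<phi>\<close>, \<open>f\<close> at \<open>x\<close>; they
  are finite sublinear functions on \<open>X0\<close>. Since \<open>(- \<phi>)\<degree>(x, v) = \<phi>\<degree>(x, - v)\<close>, splitting the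
  difference quotient of the product gives \<open>(\<phi> f)\<degree>(x, v) \<le> p (a v) + r (b v)\<close> whatever the signs of
  \<open>a\<close> and \<open>b\<close>. So for \<open>\<zeta>\<close> in the subdifferential of the product, the functional \<open>(a v, b v) \<mapsto> \<zeta> v\<close> is
  dominated by the sublinear function \<open>(u, w) \<mapsto> p u + r w\<close>, and the two components of a
  Hahn-Banach extension to \<open>X0 \<times> X0\<close> are the required subgradients.\<close>

section \<open>Hahn-Banach\<close>

definition sublinear :: "('a::real_vector \<Rightarrow> real) \<Rightarrow> bool" where
  "sublinear p \<longleftrightarrow> (\<forall>x y. p (x + y) \<le> p x + p y) \<and> (\<forall>c x. c > 0 \<longrightarrow> p (c *\<^sub>R x) = c * p x)"

text \<open>Applying the scaling inequality to \<open>c *\<^sub>R x\<close> with factor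
  \<open>1 / c\<close> gives its converse, so homogeneity need only be checked in one
  direction.\<close>

lemma sublinearI:
  assumes "\<And>x y. p (x + y) \<le> p x + p y" and "\<And>c x. c > 0 \<Longrightarrow> p (c *\<^sub>R x) \<le> c * p x"
  shows "sublinear p"
  unfolding sublinear_def
proof (intro conjI allI impI)
  fix c :: real and x assume c: "c > 0"
  have "p ((1 / c) *\<^sub>R (c *\<^sub>R x)) \<le> (1 / c) * p (c *\<^sub>R x)"
    by (rule assms(2)) (use c in simp)
  hence "c * p x \<le> p (c *\<^sub>R x)" using c by (simp add: field_simps)
  with assms(2)[OF c, of x] show "p (c *\<^sub>R x) = c * p x" by simp
qed (rule assms(1))

lemma
  assumes "sublinear p"
  shows sublinear_add: "p (x + y) \<le> p x + p y"
    and sublinear_scale: "c > 0 \<Longrightarrow> p (c *\<^sub>R x) = c * p x"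
    and sublinear_zero: "p 0 = 0"
    and sublinear_minus: "- p (- x) \<le> p x"
proof -
  show add: "p (x + y) \<le> p x + p y" for x y using assms by (simp add: sublinear_def)
  show scale: "c > 0 \<Longrightarrow> p (c *\<^sub>R x) = c * p x" for c x using assms by (simp add: sublinear_def)
  show zero: "p 0 = 0" using scale[of 2 0] by simp
  show "- p (- x) \<le> p x" using add[of x "- x"] zero by simp
qed

text \<open>\<open>K\<close> is a convex cone of constraints: a linear functional below the function obtained here is
  below \<open>p\<close> and at least \<open>s\<close> at \<open>u\<close> for all \<open>(u, s) \<in> K\<close>.\<close>

lemma sublinear_lower:
  fixes p :: "'a::real_vector \<Rightarrow> real" and K :: "('a \<times> real) set"
  assumes p: "sublinear p" and zero: "(0, 0) \<in> K"
    and add: "\<And>k l. k \<in> K \<Longrightarrow> l \<in> K \<Longrightarrow> k + l \<in> K"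
    and scale: "\<And>c k. c > 0 \<Longrightarrow> k \<in> K \<Longrightarrow> c *\<^sub>R k \<in> K"
    and le: "\<And>u s. (u, s) \<in> K \<Longrightarrow> s \<le> p u"
  obtains S where "sublinear S" and "\<And>x u s. (u, s) \<in> K \<Longrightarrow> S x \<le> p (x + u) - s"
proof -
  define S where "S x = (INF (u, s)\<in>K. p (x + u) - s)" for x
  \<comment> \<open>From s \<le> p u \<le> p (x + u) + p (- x), every member is at least - p (- x),
    so the real infimum is a genuine one.\<close>
  have bdd: "bdd_below ((\<lambda>(u, s). p (x + u) - s) ` K)" for x
  proof (rule bdd_belowI2[where m = "- p (- x)"], clarify)
    fix u s assume "(u, s) \<in> K"
    with le sublinear_add[OF p, of "x + u" "- x"] show "- p (- x) \<le> p (x + u) - s"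
      by fastforce
  qed
  have upper: "S x \<le> p (x + u) - s" if "(u, s) \<in> K" for x u s
    unfolding S_def using cINF_lower[OF bdd that, of x] by simp
  have greatest: "z \<le> S x" if "\<And>u s. (u, s) \<in> K \<Longrightarrow> z \<le> p (x + u) - s" for x z
    unfolding S_def using zero that by (intro cINF_greatest) auto
  have "sublinear S"
  proof (rule sublinearI)
    fix x y
    \<comment> \<open>The two infima are removed one after the other: (w, t) stays fixed while (u,
      s) varies, and the sum of both constraints is again in K.\<close>
    have "S (x + y) - (p (y + w) - t) \<le> S x" if w: "(w, t) \<in> K" for w t
    proof (rule greatest)
      fix u s assume "(u, s) \<in> K"
      hence "(u + w, s + t) \<in> K" using add w by fastforce
      from upper[OF this, of "x + y"] sublinear_add[OF p, of "x + u" "y + w"]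
      show "S (x + y) - (p (y + w) - t) \<le> p (x + u) - s" by (simp add: algebra_simps)
    qed
    hence "S (x + y) - S x \<le> S y" by (intro greatest) (simp add: algebra_simps)
    thus "S (x + y) \<le> S x + S y" by simp
  next
    fix c :: real and x assume c: "c > 0"
    have "S (c *\<^sub>R x) / c \<le> S x"
    proof (rule greatest)
      fix u s assume "(u, s) \<in> K"
      hence "(c *\<^sub>R u, c * s) \<in> K" using scale[OF c] by fastforce
      from upper[OF this, of "c *\<^sub>R x"] sublinear_scale[OF p c, of "x + u"] c
      show "S (c *\<^sub>R x) / c \<le> p (x + u) - s"
        by (simp add: field_simps scaleR_add_right)
    qed
    thus "S (c *\<^sub>R x) \<le> c * S x" using c by (simp add: field_simps)
  qed
  with upper that show ?thesis by blast
qed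

text \<open>The pointwise infimum serves as the bound for Zorn's lemma. It is finite because - p (-
  x) \<le> - q (- x) \<le> q x. It is subadditive because, of two members q and r of a chain, the
  smaller one already gives S (x + y) \<le> q x + r y.\<close>

lemma sublinear_INF_chain:
  fixes C :: "('a::real_vector \<Rightarrow> real) set"
  assumes "C \<noteq> {}" and sub: "\<And>q. q \<in> C \<Longrightarrow> sublinear q" and le: "\<And>q. q \<in> C \<Longrightarrow> q \<le> p"
    and chain: "\<And>q r. q \<in> C \<Longrightarrow> r \<in> C \<Longrightarrow> q \<le> r \<or> r \<le> q"
  obtains S where "sublinear S" and "\<And>q. q \<in> C \<Longrightarrow> S \<le> q"
proof -
  define S where "S x = (INF q\<in>C. q x)" for x
  have bdd: "bdd_below ((\<lambda>q. q x) ` C)" for x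
  proof (rule bdd_belowI2)
    fix q assume q: "q \<in> C"
    from sublinear_minus[OF sub[OF q], of x] le[OF q] show "- p (- x) \<le> q x"
      using le_funD[of q p "- x"] by linarith
  qed
  have upper: "S x \<le> q x" if "q \<in> C" for x q
    unfolding S_def by (rule cINF_lower[OF bdd that])
  have greatest: "z \<le> S x" if "\<And>q. q \<in> C \<Longrightarrow> z \<le> q x" for x z
    unfolding S_def using assms(1) that by (rule cINF_greatest)
  have "sublinear S"
  proof (rule sublinearI)
    fix x y
    have "S (x + y) \<le> q x + r y" if q: "q \<in> C" and r: "r \<in> C" for q r
      using chain[OF q r]
    proof
      assume "q \<le> r"
      with upper[OF q, of "x + y"] sublinear_add[OF sub[OF q], of x y] le_funD[of q r y]
      show ?thesis by linarith
    next
      assume "r \<le> q"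
      with upper[OF r, of "x + y"] sublinear_add[OF sub[OF r], of x y] le_funD[of r q x]
      show ?thesis by linarith
    qed
    hence "S (x + y) - r y \<le> S x" if "r \<in> C" for r
      using that by (intro greatest) (simp add: algebra_simps)
    hence "S (x + y) - S x \<le> S y" by (intro greatest) (simp add: algebra_simps)
    thus "S (x + y) \<le> S x + S y" by simp
  next
    fix c :: real and x assume c: "c > 0"
    have "S (c *\<^sub>R x) / c \<le> S x"
    proof (rule greatest)
      fix q assume q: "q \<in> C"
      from upper[OF q, of "c *\<^sub>R x"] sublinear_scale[OF sub[OF q] c, of x] c
      show "S (c *\<^sub>R x) / c \<le> q x" by (simp add: field_simps)
    qed
    thus "S (c *\<^sub>R x) \<le> c * S x" using c by (simp add: field_simps)
  qed
  with upper show ?thesis by (intro that) (auto simp: le_fun_def)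
qed

text \<open>Lowering m along the ray through y by \<open>sublinear_lower\<close> cannot change it,
  by minimality. This makes m superadditive, hence additive.\<close>

lemma sublinear_minimal_linear:
  fixes m :: "'a::real_vector \<Rightarrow> real"
  assumes m: "sublinear m" and minimal: "\<And>q. sublinear q \<Longrightarrow> q \<le> m \<Longrightarrow> q = m"
  shows "linear m"
proof -
  have ge: "m x + m y \<le> m (x + y)" for x y
  proof -
    \<comment> \<open>The cone generated by (y, m y): a function lowered by it satisfies S x \<le> m
      (x + y) - m y at t = 1.\<close>
    let ?K = "{(t *\<^sub>R y, t * m y) | t. t \<ge> 0}"
    obtain S where S: "sublinear S" "\<And>x u s. (u, s) \<in> ?K \<Longrightarrow> S x \<le> m (x + u) - s"
    proof (rule sublinear_lower[OF m, of ?K])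
      show "(0, 0) \<in> ?K" by (auto intro: exI[of _ 0])
      show "k + l \<in> ?K" if k: "k \<in> ?K" and l: "l \<in> ?K" for k l
      proof -
        from k l obtain s t where "s \<ge> 0" "t \<ge> 0" "k = (s *\<^sub>R y, s * m y)" "l = (t *\<^sub>R y, t * m y)"
          by blast
        thus ?thesis by (auto simp: algebra_simps intro!: exI[of _ "s + t"])
      qed
      show "c *\<^sub>R k \<in> ?K" if c: "c > 0" and k: "k \<in> ?K" for c k
      proof -
        from k obtain t where "t \<ge> 0" "k = (t *\<^sub>R y, t * m y)" by blast
        thus ?thesis using c by (auto intro!: exI[of _ "c * t"])
      qed
      show "s \<le> m u" if us: "(u, s) \<in> ?K" for u s
      proof -
        from us obtain t where t: "t \<ge> 0" "u = t *\<^sub>R y" "s = t * m y" by blast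
        show ?thesis
          by (cases "t = 0") (use t sublinear_zero[OF m] sublinear_scale[OF m, of t y] in auto)
      qed
    qed blast
    have "(0, 0) \<in> ?K" by (auto intro: exI[of _ 0])
    from S(2)[OF this] have "S \<le> m" by (simp add: le_fun_def)
    hence "S = m" using minimal S(1) by blast
    moreover have "(y, m y) \<in> ?K" by (auto intro: exI[of _ 1])
    ultimately show ?thesis using S(2)[of y "m y" x] by simp
  qed
  have add: "m (x + y) = m x + m y" for x y
    using ge[of x y] sublinear_add[OF m, of x y] by simp
  have neg: "m (- x) = - m x" for x
    using add[of x "- x"] sublinear_zero[OF m] by simp
  show ?thesis
  proof (rule linearI)
    fix c :: real and x
    consider "c = 0" | "c > 0" | "- c > 0" by linarith
    thus "m (c *\<^sub>R x) = c *\<^sub>R m x"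
    proof cases
      case 3
      from sublinear_scale[OF m this, of x] neg[of "c *\<^sub>R x"] show ?thesis by simp
    qed (simp_all add: sublinear_zero[OF m] sublinear_scale[OF m])
  qed (rule add)
qed

text \<open>Zorn's lemma for the reversed pointwise order on the sublinear functions below p: a
  maximal element there is a minimal sublinear function, hence linear.\<close>

lemma sublinear_ge_linear:
  fixes p :: "'a::real_vector \<Rightarrow> real"
  assumes p: "sublinear p"
  obtains \<Lambda> where "linear \<Lambda>" and "\<Lambda> \<le> p"
proof -
  let ?A = "{q. sublinear q \<and> q \<le> p}" and ?P = "\<lambda>q r :: 'a \<Rightarrow> real. r \<le> q"
  have "\<exists>m\<in>?A. \<forall>q\<in>?A. ?P m q \<longrightarrow> q = m"
  proof (rule predicate_Zorn)
    show "partial_order_on ?A (relation_of ?P ?A)"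
      by (rule partial_order_on_relation_ofI) auto
    show "\<exists>u\<in>?A. \<forall>q\<in>C. ?P q u" if C: "C \<in> Chains (relation_of ?P ?A)" for C
    proof (cases "C = {}")
      case False
      have sub: "C \<subseteq> ?A" and chain: "\<And>q r. q \<in> C \<Longrightarrow> r \<in> C \<Longrightarrow> q \<le> r \<or> r \<le> q"
        using C by (auto simp: Chains_def relation_of_def)
      from sublinear_INF_chain[OF False _ _ chain, of p] sub
      obtain S where S: "sublinear S" "\<And>q. q \<in> C \<Longrightarrow> S \<le> q" by blast
      from False sub S(2) have "S \<le> p" by (blast intro: order_trans)
      with S show ?thesis by blast
    qed (use p in auto)
  qed
  then obtain m where m: "sublinear m" "m \<le> p"
    and min: "\<And>q. sublinear q \<Longrightarrow> q \<le> p \<Longrightarrow> q \<le> m \<Longrightarrow> q = m" by auto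
  have "linear m" using m min by (intro sublinear_minimal_linear) (blast intro: order_trans)+
  with m(2) that show ?thesis by blast
qed

text \<open>First p is lowered by the constraints in K, then a linear function is taken below the
  result. The constraint (0, 0) gives the upper bound by p; evaluating at - u gives the lower bound
  s at u.\<close>

lemma Hahn_Banach_cone:
  fixes p :: "'a::real_vector \<Rightarrow> real" and K :: "('a \<times> real) set"
  assumes p: "sublinear p" and "(0, 0) \<in> K"
    and "\<And>k l. k \<in> K \<Longrightarrow> l \<in> K \<Longrightarrow> k + l \<in> K"
    and "\<And>c k. c > 0 \<Longrightarrow> k \<in> K \<Longrightarrow> c *\<^sub>R k \<in> K"
    and "\<And>u s. (u, s) \<in> K \<Longrightarrow> s \<le> p u"
  obtains \<Lambda> where "linear \<Lambda>" and "\<And>x. \<Lambda> x \<le> p x" and "\<And>u s. (u, s) \<in> K \<Longrightarrow> s \<le> \<Lambda> u"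
proof -
  obtain S where S: "sublinear S" "\<And>x u s. (u, s) \<in> K \<Longrightarrow> S x \<le> p (x + u) - s"
    using sublinear_lower[OF assms] by blast
  obtain \<Lambda> where \<Lambda>: "linear \<Lambda>" "\<Lambda> \<le> S" using sublinear_ge_linear[OF S(1)] .
  show ?thesis
  proof (rule that)
    show "\<Lambda> x \<le> p x" for x
      using le_funD[OF \<Lambda>(2), of x] S(2)[OF assms(2), of x] by simp
    show "s \<le> \<Lambda> u" if "(u, s) \<in> K" for u s
      using le_funD[OF \<Lambda>(2), of "- u"] S(2)[OF that, of "- u"] sublinear_zero[OF p]
        linear_neg[OF \<Lambda>(1), of u] by simp
  qed (rule \<Lambda>(1))
qed

section \<open>Minkowski functionals\<close>

text \<open>The axioms are confined to \<open>X0\<close> because outside the span of D the Minkowski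
  functional is the infimum of an empty set.\<close>

locale seminorm_on =
  fixes X0 :: "'a::real_vector set" and q :: "'a \<Rightarrow> real"
  assumes subspace: "subspace X0"
    and triangle: "u \<in> X0 \<Longrightarrow> v \<in> X0 \<Longrightarrow> q (u + v) \<le> q u + q v"
    and scale: "v \<in> X0 \<Longrightarrow> q (c *\<^sub>R v) = \<bar>c\<bar> * q v"
begin

lemma zero: "q 0 = 0"
  using scale[of 0 0] subspace_0[OF subspace] by simp

lemma nonneg: "v \<in> X0 \<Longrightarrow> 0 \<le> q v"
  using triangle[of v "(-1) *\<^sub>R v"] scale[of v "-1"] zero subspace_scale[OF subspace, of v "-1"]
  by simp

end

lemma seminorm_on_add:
  assumes "seminorm_on X0 p" and "seminorm_on X0 q"
  shows "seminorm_on X0 (\<lambda>v. p v + q v)"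
proof -
  interpret p: seminorm_on X0 p by fact
  interpret q: seminorm_on X0 q by fact
  show ?thesis
  proof
    show "p (u + v) + q (u + v) \<le> (p u + q u) + (p v + q v)" if "u \<in> X0" "v \<in> X0" for u v
      using p.triangle[OF that] q.triangle[OF that] by simp
  qed (simp_all add: p.subspace p.scale q.scale distrib_left)
qed

locale convex_symmetric =
  fixes D :: "'a::real_vector set"
  assumes convex: "convex D" and zero_mem: "0 \<in> D" and uminus_mem: "d \<in> D \<Longrightarrow> - d \<in> D"
begin

abbreviation q where "q \<equiv> minkowski_functional D"

text \<open>This is convexity with weights s / (s + t) and t / (s + t). It gives both the closure of
  the dilates under sums and the triangle inequality.\<close>

lemma dilate_add:
  assumes "s > 0" "t > 0" "d \<in> D" "e \<in> D"
  shows "\<exists>k\<in>D. s *\<^sub>R d + t *\<^sub>R e = (s + t) *\<^sub>R k"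
proof
  show "(s / (s + t)) *\<^sub>R d + (t / (s + t)) *\<^sub>R e \<in> D"
    using assms by (intro convexD[OF convex]) (auto simp flip: add_divide_distrib)
  show "s *\<^sub>R d + t *\<^sub>R e = (s + t) *\<^sub>R ((s / (s + t)) *\<^sub>R d + (t / (s + t)) *\<^sub>R e)"
    using assms by (simp add: scaleR_add_right)
qed

lemma dilate_scale:
  assumes "t > 0" "d \<in> D" "c \<noteq> 0"
  shows "\<exists>k\<in>D. c *\<^sub>R t *\<^sub>R d = (\<bar>c\<bar> * t) *\<^sub>R k"
proof (cases "c > 0")
  case True
  thus ?thesis using assms by auto
next
  case False
  thus ?thesis using assms uminus_mem[OF assms(2)] by (intro bexI[of _ "- d"]) auto
qed

text \<open>The union of the positive dilates of D is a subspace, closed under sums by convexity and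
  under scalars by symmetry. Hence the infimum defining \<open>q\<close> is over a nonempty set on
  all of the span.\<close>

lemma span_absorb:
  assumes "v \<in> span D"
  shows "\<exists>t>0. \<exists>d\<in>D. v = t *\<^sub>R d"
proof -
  let ?S = "{v. \<exists>t>0. \<exists>d\<in>D. v = t *\<^sub>R d}"
  have "subspace ?S"
  proof (rule subspaceI)
    show zero: "0 \<in> ?S" using zero_mem by (auto intro!: exI[of _ 1])
    show "u + v \<in> ?S" if "u \<in> ?S" "v \<in> ?S" for u v
    proof -
      from that obtain s d t e
        where *: "s > 0" "t > 0" "d \<in> D" "e \<in> D" "u = s *\<^sub>R d" "v = t *\<^sub>R e" by blast
      with dilate_add[OF *(1-4)] show ?thesis by (auto intro!: exI[of _ "s + t"])
    qed
    show "c *\<^sub>R v \<in> ?S" if "v \<in> ?S" for c v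
    proof (cases "c = 0")
      case False
      from that obtain t d where *: "t > 0" "d \<in> D" "v = t *\<^sub>R d" by blast
      with dilate_scale[OF *(1,2) False] False show ?thesis by (auto intro!: exI[of _ "\<bar>c\<bar> * t"])
    qed (use zero in simp)
  qed
  moreover have "D \<subseteq> ?S" by (auto intro!: exI[of _ 1])
  ultimately have "span D \<subseteq> ?S" by (rule span_minimal[rotated])
  with assms show ?thesis by blast
qed

lemma minkowski_le:
  assumes "t > 0" "d \<in> D"
  shows "q (t *\<^sub>R d) \<le> t"
  unfolding minkowski_functional_def using assms
  by (intro cInf_lower bdd_belowI[of _ 0]) auto

lemma minkowski_less:
  assumes "v \<in> span D" "q v < s"
  obtains t d where "0 < t" "t < s" "d \<in> D" "v = t *\<^sub>R d"
proof -
  have "{t. 0 < t \<and> v \<in> (\<lambda>d. t *\<^sub>R d) ` D} \<noteq> {}"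
    using span_absorb[OF assms(1)] by blast
  from cInf_lessD[OF this assms(2)[unfolded minkowski_functional_def]] that show ?thesis by blast
qed

text \<open>Here v = t d with 0 < t < 1 is a convex combination of d and 0. This is what later
  places points close to x in the domain of the function.\<close>

lemma minkowski_less_one:
  assumes "v \<in> span D" "q v < 1"
  shows "v \<in> D"
proof -
  from minkowski_less[OF assms] obtain t d where "0 < t" "t < 1" "d \<in> D" "v = t *\<^sub>R d" .
  thus ?thesis using convexD[OF convex, of d 0 t "1 - t"] zero_mem by simp
qed

lemma minkowski_nonneg: "v \<in> span D \<Longrightarrow> 0 \<le> q v"
  using minkowski_less[of v 0] by (metis less_asym not_le)

lemma minkowski_scale_le:
  assumes v: "v \<in> span D" and c: "c \<noteq> 0"
  shows "q (c *\<^sub>R v) \<le> \<bar>c\<bar> * q v"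
proof -
  have "q (c *\<^sub>R v) / \<bar>c\<bar> \<le> s" if s: "q v < s" for s
  proof -
    from minkowski_less[OF v s] obtain t d where *: "0 < t" "t < s" "d \<in> D" "v = t *\<^sub>R d" .
    from dilate_scale[OF *(1,3) c] obtain k where "k \<in> D" "c *\<^sub>R v = (\<bar>c\<bar> * t) *\<^sub>R k"
      using *(4) by blast
    with minkowski_le[of "\<bar>c\<bar> * t" k] c * have "q (c *\<^sub>R v) \<le> \<bar>c\<bar> * t" by simp
    also have "\<dots> \<le> \<bar>c\<bar> * s" using * by (intro mult_left_mono) auto
    finally show ?thesis using c by (simp add: field_simps)
  qed
  hence "q (c *\<^sub>R v) / \<bar>c\<bar> \<le> q v" by (rule dense_ge)
  thus ?thesis using c by (simp add: field_simps)
qed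

sublocale seminorm_on "span D" q
proof
  show "subspace (span D)" by (rule subspace_span)
  show "q (u + v) \<le> q u + q v" if u: "u \<in> span D" and v: "v \<in> span D" for u v
  proof (rule field_le_epsilon)
    fix e :: real assume "e > 0"
    hence "q u < q u + e / 2" "q v < q v + e / 2" by auto
    from minkowski_less[OF u this(1)] minkowski_less[OF v this(2)] obtain s d t e'
      where *: "0 < s" "0 < t" "d \<in> D" "e' \<in> D" "u = s *\<^sub>R d" "v = t *\<^sub>R e'"
        and less: "s < q u + e / 2" "t < q v + e / 2" by metis
    from dilate_add[OF *(1-4)] obtain k where "k \<in> D" "u + v = (s + t) *\<^sub>R k" using * by blast
    with minkowski_le[of "s + t" k] * have "q (u + v) \<le> s + t" by simp
    with less show "q (u + v) \<le> q u + q v + e" by simp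
  qed
  show "q (c *\<^sub>R v) = \<bar>c\<bar> * q v" if v: "v \<in> span D" for c v
  proof (cases "c = 0")
    case True
    have "q 0 \<le> t" if "t > 0" for t using minkowski_le[OF that zero_mem] by simp
    hence "q 0 \<le> 0" by (rule dense_ge)
    with minkowski_nonneg[of 0] True show ?thesis by (simp add: span_zero)
  next
    case False
    \<comment> \<open>The reverse inequality is the same estimate for the vector
      \<open>c *\<^sub>R v\<close> and the factor \<open>1 / c\<close>.\<close>
    from minkowski_scale_le[of "c *\<^sub>R v" "1 / c"] False v
    have "\<bar>c\<bar> * q v \<le> q (c *\<^sub>R v)" by (simp add: span_scale field_simps)
    with minkowski_scale_le[OF v False] show ?thesis by simp
  qed
qed

end

section \<open>Clarke derivatives\<close>

text \<open>Naming the filter inside \<open>clarke_derivative\<close> lets estimates be stated as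
  \<open>eventually\<close> facts and moved from one seminorm to another.\<close>

definition clarke_filter ::
    "'a::real_vector set \<Rightarrow> ('a \<Rightarrow> real) \<Rightarrow> 'a \<Rightarrow> ('a \<times> real) filter" where
  "clarke_filter X0 q x =
     inf (filtercomap (\<lambda>y. q (y - x)) (nhds 0)) (principal {y. y - x \<in> X0}) \<times>\<^sub>F at_right 0"

lemma clarke_derivative_Limsup:
  "clarke_derivative X0 q h x v =
     Limsup (clarke_filter X0 q x) (\<lambda>(y, t). ereal ((h (y + t *\<^sub>R v) - h y) / t))"
  by (simp add: clarke_derivative_def clarke_filter_def)

lemma clarke_derivative_le_iff:
  "clarke_derivative X0 q h x v \<le> ereal c \<longleftrightarrow>
     (\<forall>e>0. \<forall>\<^sub>F (y, t) in clarke_filter X0 q x. (h (y + t *\<^sub>R v) - h y) / t < c + e)"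
  (is "?l \<longleftrightarrow> ?r")
proof
  assume ?l
  show ?r
  proof (intro allI impI)
    fix e :: real assume "e > 0"
    hence "ereal c < ereal (c + e)" by simp
    with \<open>?l\<close> show "\<forall>\<^sub>F (y, t) in clarke_filter X0 q x. (h (y + t *\<^sub>R v) - h y) / t < c + e"
      unfolding clarke_derivative_Limsup Limsup_le_iff by (fastforce elim: eventually_mono)
  qed
next
  assume r: ?r
  show ?l
    unfolding clarke_derivative_Limsup Limsup_le_iff
  proof (intro allI impI)
    fix z assume "z > ereal c"
    \<comment> \<open>A real d strictly between is used because z may be infinite; e = d - c is then
      a real tolerance.\<close>
    then obtain d where d: "ereal c < ereal d" "ereal d < z" using ereal_dense2 by blast
    hence "d - c > 0" by simp
    with r have "\<forall>\<^sub>F (y, t) in clarke_filter X0 q x. (h (y + t *\<^sub>R v) - h y) / t < c + (d - c)"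
      by blast
    thus "\<forall>\<^sub>F p in clarke_filter X0 q x. (case p of (y, t) \<Rightarrow> ereal ((h (y + t *\<^sub>R v) - h y) / t)) < z"
      by eventually_elim (auto intro!: less_trans[OF _ d(2)])
  qed
qed

context seminorm_on
begin

text \<open>A single d can bound both variables by taking the minimum of the two radii, and
  \<open>nonneg\<close> removes the absolute value from the neighbourhood of 0.\<close>

lemma eventually_clarke_filter:
  "eventually P (clarke_filter X0 q x) \<longleftrightarrow>
     (\<exists>d>0. \<forall>y t. y - x \<in> X0 \<longrightarrow> q (y - x) < d \<longrightarrow> 0 < t \<longrightarrow> t < d \<longrightarrow> P (y, t))"
  (is "?l \<longleftrightarrow> ?r")
proof
  assume ?l
  then obtain A B where
    A: "eventually A (inf (filtercomap (\<lambda>y. q (y - x)) (nhds 0)) (principal {y. y - x \<in> X0}))"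
    and B: "eventually B (at_right 0)" and AB: "\<And>y t. A y \<Longrightarrow> B t \<Longrightarrow> P (y, t)"
    unfolding clarke_filter_def eventually_prod_filter by blast
  from A obtain d where d: "d > 0" "\<And>y. y - x \<in> X0 \<Longrightarrow> \<bar>q (y - x)\<bar> < d \<Longrightarrow> A y"
    by (auto simp: eventually_inf_principal eventually_filtercomap eventually_nhds_metric)
  from B obtain b where b: "b > 0" "\<And>t. 0 < t \<Longrightarrow> t < b \<Longrightarrow> B t"
    by (auto simp: eventually_at_right_field)
  show ?r using d b AB nonneg by (intro exI[of _ "min d b"]) auto
next
  assume ?r
  then obtain d where
    d: "d > 0" "\<And>y t. y - x \<in> X0 \<Longrightarrow> q (y - x) < d \<Longrightarrow> 0 < t \<Longrightarrow> t < d \<Longrightarrow> P (y, t)" by blast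
  have "eventually (\<lambda>y. q (y - x) < d) (filtercomap (\<lambda>y. q (y - x)) (nhds 0))"
    using d(1) by (intro eventually_filtercomapI eventually_nhds_in_open[of "{..<d}", simplified]) auto
  hence "eventually (\<lambda>y. y - x \<in> X0 \<and> q (y - x) < d)
      (inf (filtercomap (\<lambda>y. q (y - x)) (nhds 0)) (principal {y. y - x \<in> X0}))"
    by (auto simp: eventually_inf_principal elim: eventually_mono)
  moreover have "eventually (\<lambda>t. 0 < t \<and> t < d) (at_right 0)"
    using d(1) by (auto simp: eventually_at_right_field)
  ultimately show ?l unfolding clarke_filter_def eventually_prod_filter using d(2) by blast
qed

text \<open>Lower bounds on the Limsup need a proper filter. Since y = x is allowed, the pair (x, d
  / 2) lies in every basic set.\<close>

lemma clarke_filter_neq_bot: "clarke_filter X0 q x \<noteq> bot"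
proof
  assume "clarke_filter X0 q x = bot"
  hence "eventually (\<lambda>_. False) (clarke_filter X0 q x)" by simp
  then obtain d where "d > 0" "\<And>y t. y - x \<in> X0 \<Longrightarrow> q (y - x) < d \<Longrightarrow> 0 < t \<Longrightarrow> t < d \<Longrightarrow> False"
    unfolding eventually_clarke_filter by blast
  from this(2)[of x "d / 2"] this(1) zero subspace_0[OF subspace] show False by simp
qed

text \<open>This is the change of variables behind all the calculus below: moving the base point
  along v and rescaling the step both preserve the limit.\<close>

lemma clarke_filter_shift:
  assumes v: "v \<in> X0" and c: "c > 0" and "eventually P (clarke_filter X0 q x)"
  shows "\<forall>\<^sub>F (y, t) in clarke_filter X0 q x. P (y + t *\<^sub>R v, c * t)"
proof -
  from assms(3) obtain d where
    d: "d > 0" "\<And>y t. y - x \<in> X0 \<Longrightarrow> q (y - x) < d \<Longrightarrow> 0 < t \<Longrightarrow> t < d \<Longrightarrow> P (y, t)"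
    unfolding eventually_clarke_filter by blast
  \<comment> \<open>The first bound gives q (y + t v - x) < e (1 + q v) \<le> d, the second gives c
    t < d. The summand 1 keeps the denominator positive when q v = 0.\<close>
  define e where "e = min (d / (1 + q v)) (d / c)"
  have pos: "1 + q v > 0" using nonneg[OF v] by simp
  have "e > 0" using d(1) c pos by (simp add: e_def)
  moreover have "P (y + t *\<^sub>R v, c * t)"
    if y: "y - x \<in> X0" "q (y - x) < e" and t: "0 < t" "t < e" for y t
  proof (rule d(2))
    have *: "y + t *\<^sub>R v - x = (y - x) + t *\<^sub>R v" by simp
    show "y + t *\<^sub>R v - x \<in> X0"
      unfolding * using y v subspace by (intro subspace_add subspace_scale)
    have "q (y + t *\<^sub>R v - x) \<le> q (y - x) + t * q v"
      unfolding * using triangle[OF y(1) subspace_scale[OF subspace v, of t]] scale[OF v, of t] t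
      by simp
    also have "\<dots> < e + e * q v"
      using y t nonneg[OF v] by (intro add_less_le_mono mult_right_mono) auto
    also have "\<dots> = e * (1 + q v)" by (simp add: algebra_simps)
    also have "\<dots> \<le> d / (1 + q v) * (1 + q v)"
      using pos by (intro mult_right_mono) (auto simp: e_def)
    also have "\<dots> = d" using pos by simp
    finally show "q (y + t *\<^sub>R v - x) < d" .
    show "0 < c * t" using c t by simp
    have "t < d / c" using t by (simp add: e_def)
    thus "c * t < d" using c by (simp add: field_simps)
  qed
  ultimately show ?thesis unfolding eventually_clarke_filter by auto
qed

end

text \<open>A larger seminorm has smaller balls, hence a finer filter. Estimates for \<mu> and for
  \<nu> thereby become estimates for \<mu> + \<nu>.\<close>

lemma clarke_filter_mono:
  assumes "seminorm_on X0 p" "seminorm_on X0 q" and le: "\<And>v. v \<in> X0 \<Longrightarrow> p v \<le> q v"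
  shows "clarke_filter X0 q x \<le> clarke_filter X0 p x"
  unfolding le_filter_def seminorm_on.eventually_clarke_filter[OF assms(1)]
    seminorm_on.eventually_clarke_filter[OF assms(2)]
  using le by (meson le_less_trans)

section \<open>Directional derivatives of functions that are Lipschitz near a point\<close>

locale lipschitz_at = seminorm_on X0 q
  for X0 :: "'a::real_vector set" and q :: "'a \<Rightarrow> real" +
  fixes h :: "'a \<Rightarrow> real" and x :: 'a and r L :: real
  assumes r_pos: "r > 0" and L_nonneg: "L \<ge> 0"
    and lipschitz: "y - x \<in> X0 \<Longrightarrow> z - x \<in> X0 \<Longrightarrow> q (y - x) < r \<Longrightarrow> q (z - x) < r \<Longrightarrow>
      \<bar>h y - h z\<bar> \<le> L * q (y - z)"
begin

lemma eventually_ball: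
  "e > 0 \<Longrightarrow> \<forall>\<^sub>F (y, t) in clarke_filter X0 q x. y - x \<in> X0 \<and> q (y - x) < e \<and> t > 0"
  unfolding eventually_clarke_filter by auto

lemma eventually_ball_shift:
  "e > 0 \<Longrightarrow> v \<in> X0 \<Longrightarrow>
    \<forall>\<^sub>F (y, t) in clarke_filter X0 q x. y + t *\<^sub>R v - x \<in> X0 \<and> q (y + t *\<^sub>R v - x) < e"
  using clarke_filter_shift[OF _ zero_less_one eventually_ball] by (fastforce elim: eventually_mono)

lemma eventually_quotient_bound:
  assumes v: "v \<in> X0"
  shows "\<forall>\<^sub>F (y, t) in clarke_filter X0 q x. \<bar>(h (y + t *\<^sub>R v) - h y) / t\<bar> \<le> L * q v"
  using eventually_ball[OF r_pos] eventually_ball_shift[OF r_pos v]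
proof eventually_elim
  case (elim p)
  obtain y t where p: "p = (y, t)" by (cases p)
  with elim have "\<bar>h (y + t *\<^sub>R v) - h y\<bar> \<le> L * q (y + t *\<^sub>R v - y)" and t: "t > 0"
    using lipschitz[of "y + t *\<^sub>R v" y] by auto
  hence "\<bar>h (y + t *\<^sub>R v) - h y\<bar> \<le> (L * q v) * t" using scale[OF v, of t] by (simp add: mult_ac)
  thus ?case using t by (simp add: p field_simps)
qed

lemma eventually_close:
  assumes "v \<in> X0" and e: "e > 0"
  shows "\<forall>\<^sub>F (y, t) in clarke_filter X0 q x. \<bar>h (y + t *\<^sub>R v) - h x\<bar> \<le> e"
proof -
  \<comment> \<open>The denominator is L + 1 because L may be 0.\<close>
  have "min r (e / (L + 1)) > 0" using r_pos L_nonneg e by simp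
  from eventually_ball_shift[OF this assms(1)] show ?thesis
  proof eventually_elim
    case (elim p)
    obtain y t where p: "p = (y, t)" by (cases p)
    let ?z = "y + t *\<^sub>R v"
    from elim p have z: "?z - x \<in> X0" "q (?z - x) < r" "q (?z - x) \<le> e / (L + 1)" by auto
    have "\<bar>h ?z - h x\<bar> \<le> L * q (?z - x)"
      by (rule lipschitz) (use z zero r_pos subspace_0[OF subspace] in auto)
    also have "\<dots> \<le> (L + 1) * (e / (L + 1))"
      using z nonneg[OF z(1)] L_nonneg by (intro mult_mono) auto
    also have "\<dots> = e" using L_nonneg by simp
    finally show ?case using p by simp
  qed
qed

definition deriv :: "'a \<Rightarrow> real" where
  "deriv v = real_of_ereal (clarke_derivative X0 q h x v)"

text \<open>The difference quotients are eventually bounded by L q v in absolute value, so the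
  extended real Limsup is finite.\<close>

lemma
  assumes v: "v \<in> X0"
  shows clarke_derivative_eq: "clarke_derivative X0 q h x v = ereal (deriv v)"
    and deriv_bound: "\<bar>deriv v\<bar> \<le> L * q v"
proof -
  let ?d = "clarke_derivative X0 q h x v"
  have "?d \<le> ereal (L * q v)"
    unfolding clarke_derivative_Limsup using eventually_quotient_bound[OF v]
    by (intro Limsup_bounded) (auto simp: abs_le_iff simp del: abs_divide elim!: eventually_mono)
  moreover have "ereal (- (L * q v)) \<le> ?d"
    unfolding clarke_derivative_Limsup using eventually_quotient_bound[OF v]
    by (intro le_Limsup[OF clarke_filter_neq_bot]) (auto simp: abs_le_iff simp del: abs_divide elim!: eventually_mono)
  ultimately show "?d = ereal (deriv v)" "\<bar>deriv v\<bar> \<le> L * q v"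
    unfolding deriv_def by (cases ?d; simp)+
qed

lemma deriv_le_iff:
  "v \<in> X0 \<Longrightarrow> deriv v \<le> c \<longleftrightarrow>
     (\<forall>e>0. \<forall>\<^sub>F (y, t) in clarke_filter X0 q x. (h (y + t *\<^sub>R v) - h y) / t < c + e)"
  by (simp flip: clarke_derivative_le_iff add: clarke_derivative_eq)

lemma eventually_quotient_less:
  "v \<in> X0 \<Longrightarrow> e > 0 \<Longrightarrow>
    \<forall>\<^sub>F (y, t) in clarke_filter X0 q x. (h (y + t *\<^sub>R v) - h y) / t < deriv v + e"
  using deriv_le_iff[of v "deriv v"] by blast

lemma deriv_zero: "deriv 0 = 0"
  using deriv_bound[of 0] zero subspace_0[OF subspace] by simp

text \<open>For \<open>a < 0\<close> the substitution \<open>y \<mapsto> y + t v\<close> swaps the two values in the difference quotient.\<close>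

lemma eventually_scaled_quotient_less:
  assumes v: "v \<in> X0" and e: "e > 0"
  shows "\<forall>\<^sub>F (y, t) in clarke_filter X0 q x.
    a * ((h (y + t *\<^sub>R v) - h y) / t) < deriv (a *\<^sub>R v) + e"
proof -
  note ev = eventually_quotient_less[OF subspace_scale[OF subspace v, of a] e]
  consider "a = 0" | "a > 0" | "a < 0" by linarith
  thus ?thesis
  proof cases
    case 1
    thus ?thesis using e by (simp add: deriv_zero case_prod_unfold)
  next
    case 2
    \<comment> \<open>With zero shift only the step changes, from t to t / a; in direction a v it
      reaches y + t v.\<close>
    hence "1 / a > 0" by simp
    from clarke_filter_shift[OF subspace_0[OF subspace] this ev] show ?thesis
      by eventually_elim (use 2 in \<open>auto simp: field_simps\<close>)
  next
    case 3
    \<comment> \<open>From the base point y + t v, the step - t / a in direction a v leads back to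
      y.\<close>
    hence "- 1 / a > 0" by simp
    from clarke_filter_shift[OF v this ev] show ?thesis
      by eventually_elim (use 3 in \<open>auto simp: field_simps diff_divide_distrib\<close>)
  qed
qed

text \<open>The quotient along u + v at y is the quotient along u at y plus the quotient along v at
  y + t u, and the shifted base point still tends to x.\<close>

lemma deriv_add:
  assumes u: "u \<in> X0" and v: "v \<in> X0"
  shows "deriv (u + v) \<le> deriv u + deriv v"
  unfolding deriv_le_iff[OF subspace_add[OF subspace u v]]
proof (intro allI impI)
  fix e :: real assume "e > 0"
  hence e: "e / 2 > 0" by simp
  from clarke_filter_shift[OF u zero_less_one eventually_quotient_less[OF v e]]
    eventually_quotient_less[OF u e]
  show "\<forall>\<^sub>F (y, t) in clarke_filter X0 q x.
      (h (y + t *\<^sub>R (u + v)) - h y) / t < deriv u + deriv v + e"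
    by eventually_elim (auto simp: scaleR_add_right add.assoc diff_divide_distrib)
qed

lemma deriv_scale_le:
  assumes v: "v \<in> X0" and c: "c > 0"
  shows "deriv (c *\<^sub>R v) \<le> c * deriv v"
proof -
  \<comment> \<open>The vector v is left as \<open>(1 / c) *\<^sub>R c *\<^sub>R v\<close> to match
    \<open>eventually_scaled_quotient_less\<close> with factor \<open>1 / c\<close> and direction
    \<open>c *\<^sub>R v\<close>.\<close>
  have "deriv (c *\<^sub>R v) \<le> deriv ((1 / c) *\<^sub>R c *\<^sub>R v) * c"
    unfolding deriv_le_iff[OF subspace_scale[OF subspace v, of c]]
  proof (intro allI impI)
    fix e :: real assume "e > 0"
    hence "e / c > 0" using c by simp
    from eventually_scaled_quotient_less[OF subspace_scale[OF subspace v, of c] this, of "1 / c"]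
    show "\<forall>\<^sub>F (y, t) in clarke_filter X0 q x.
        (h (y + t *\<^sub>R c *\<^sub>R v) - h y) / t < deriv ((1 / c) *\<^sub>R c *\<^sub>R v) * c + e"
    proof eventually_elim
      case (elim p)
      obtain y t where p: "p = (y, t)" by (cases p)
      let ?Q = "(h (y + t *\<^sub>R c *\<^sub>R v) - h y) / t"
      from elim p have "1 / c * ?Q < deriv ((1 / c) *\<^sub>R c *\<^sub>R v) + e / c" by simp
      from mult_strict_right_mono[OF this c] c
      have "?Q < deriv ((1 / c) *\<^sub>R c *\<^sub>R v) * c + e" by (simp add: distrib_right)
      thus ?case by (simp add: p)
    qed
  qed
  thus ?thesis using c by (simp add: mult.commute)
qed

text \<open>The estimates for \<open>deriv\<close> hold on \<open>X0\<close> only, whereas the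
  Hahn-Banach lemmas concern functions on a whole space; a linear map into \<open>X0\<close> bridges
  the two.\<close>

lemma sublinear_deriv_comp:
  assumes \<pi>: "linear \<pi>" "range \<pi> \<subseteq> X0"
  shows "sublinear (\<lambda>v. deriv (\<pi> v))"
proof (rule sublinearI)
  have mem: "\<pi> v \<in> X0" for v using \<pi>(2) by blast
  show "deriv (\<pi> (u + v)) \<le> deriv (\<pi> u) + deriv (\<pi> v)" for u v
    using deriv_add[OF mem mem] by (simp add: linear_add[OF \<pi>(1)])
  show "deriv (\<pi> (c *\<^sub>R v)) \<le> c * deriv (\<pi> v)" if "c > 0" for c v
    using deriv_scale_le[OF mem that] by (simp add: linear_scale[OF \<pi>(1)])
qed

end

section \<open>Product rule and splitting of subgradients\<close>

lemma clarke_derivative_mult_le: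
  assumes "lipschitz_at X0 p \<phi> x r L" and "lipschitz_at X0 q f x s M" and v: "v \<in> X0"
  shows "clarke_derivative X0 (\<lambda>v. p v + q v) (\<lambda>y. \<phi> y * f y) x v \<le>
    ereal (lipschitz_at.deriv X0 p \<phi> x (f x *\<^sub>R v) + lipschitz_at.deriv X0 q f x (\<phi> x *\<^sub>R v))"
proof -
  interpret \<phi>: lipschitz_at X0 p \<phi> x r L by fact
  interpret f: lipschitz_at X0 q f x s M by fact
  interpret sum: seminorm_on X0 "\<lambda>v. p v + q v"
    by (rule seminorm_on_add) unfold_locales
  let ?F = "clarke_filter X0 (\<lambda>v. p v + q v) x"
  have Fp: "?F \<le> clarke_filter X0 p x"
    by (rule clarke_filter_mono) (unfold_locales, simp add: f.nonneg)
  have Fq: "?F \<le> clarke_filter X0 q x"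
    by (rule clarke_filter_mono) (unfold_locales, simp add: \<phi>.nonneg)
  show ?thesis
    unfolding clarke_derivative_le_iff
  proof (intro allI impI)
    fix e :: real assume "e > 0"
    \<comment> \<open>The summand 1 makes B positive. Closeness d = e / (3 B) keeps the mixed error
      terms below e / 3, leaving e / 3 for each main term.\<close>
    define B where "B = L * p v + M * q v + 1"
    have Lp: "0 \<le> L * p v" and Mq: "0 \<le> M * q v"
      using \<phi>.nonneg[OF v] f.nonneg[OF v] \<phi>.L_nonneg f.L_nonneg by auto
    hence B: "B > 0" by (simp add: B_def)
    define d where "d = e / (3 * B)"
    have e: "e / 3 > 0" and d: "d > 0" using \<open>e > 0\<close> B by (auto simp: d_def)
    have dB: "d * (L * p v) + d * (M * q v) < e / 3"
    proof -
      have "d * (L * p v) + d * (M * q v) < d * B" using d by (simp add: B_def algebra_simps)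
      also have "\<dots> = e / 3" using B by (simp add: d_def)
      finally show ?thesis .
    qed
    from filter_leD[OF Fp \<phi>.eventually_scaled_quotient_less[OF v e, of "f x"]]
      filter_leD[OF Fq f.eventually_scaled_quotient_less[OF v e, of "\<phi> x"]]
      filter_leD[OF Fp \<phi>.eventually_quotient_bound[OF v]]
      filter_leD[OF Fq f.eventually_quotient_bound[OF v]]
      filter_leD[OF Fp \<phi>.eventually_close[OF v d]]
      filter_leD[OF Fq f.eventually_close[OF subspace_0[OF f.subspace] d]]
    show "\<forall>\<^sub>F (y, t) in ?F. (\<phi> (y + t *\<^sub>R v) * f (y + t *\<^sub>R v) - \<phi> y * f y) / t <
        \<phi>.deriv (f x *\<^sub>R v) + f.deriv (\<phi> x *\<^sub>R v) + e"
    proof eventually_elim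
      case (elim z)
      obtain y t where z: "z = (y, t)" by (cases z)
      define P where "P = (\<phi> (y + t *\<^sub>R v) - \<phi> y) / t"
      define R where "R = (f (y + t *\<^sub>R v) - f y) / t"
      define P' where "P' = \<phi> (y + t *\<^sub>R v) - \<phi> x"
      define R' where "R' = f y - f x"
      \<comment> \<open>Write the increment as \<phi> (y + t v) (f (y + t v) - f y) + f y (\<phi> (y
        + t v) - \<phi> y) and replace the outer factors by their values at x, with errors P' and
        R'. At t = 0 both sides vanish by the convention for division by zero.\<close>
      have "(\<phi> (y + t *\<^sub>R v) * f (y + t *\<^sub>R v) - \<phi> y * f y) / t
          = f x * P + \<phi> x * R + (P' * R + R' * P)"
        by (cases "t = 0") (simp_all add: P_def R_def P'_def R'_def field_simps)
      moreover have "P' * R + R' * P \<le> d * (M * q v) + d * (L * p v)"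
      proof (rule add_mono)
        have "\<bar>P' * R\<bar> \<le> d * (M * q v)" unfolding abs_mult
          using elim d z by (intro mult_mono) (auto simp: P'_def R_def)
        thus "P' * R \<le> d * (M * q v)" by simp
        have "\<bar>R' * P\<bar> \<le> d * (L * p v)" unfolding abs_mult
          using elim d z by (intro mult_mono) (auto simp: R'_def P_def)
        thus "R' * P \<le> d * (L * p v)" by simp
      qed
      moreover have "f x * P < \<phi>.deriv (f x *\<^sub>R v) + e / 3"
        and "\<phi> x * R < f.deriv (\<phi> x *\<^sub>R v) + e / 3"
        using elim z by (auto simp: P_def R_def)
      ultimately show ?case using dB z by simp
    qed
  qed
qed

text \<open>Cutting \<xi> off outside \<open>X0\<close> produces the representative demanded by
  \<open>algebraic_dual\<close>.\<close>

lemma clarke_subdifferentialI: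
  assumes "lipschitz_at X0 q h x r L" and "linear \<xi>"
    and le: "\<And>v. v \<in> X0 \<Longrightarrow> \<xi> v \<le> lipschitz_at.deriv X0 q h x v"
  shows "(\<lambda>v. if v \<in> X0 then \<xi> v else 0) \<in> clarke_subdifferential X0 q h x"
proof -
  interpret lipschitz_at X0 q h x r L by fact
  show ?thesis
    unfolding clarke_subdifferential_def algebraic_dual_def using le
    by (auto simp: clarke_derivative_eq linear_add[OF assms(2)] linear_scale[OF assms(2)]
        subspace_add[OF subspace] subspace_scale[OF subspace])
qed

text \<open>The radius 1 - q (x - x0) works: by the triangle inequality, the ball about x lies in
  the open unit ball about x0, hence in C.\<close>

lemma lipschitz_at_minkowski:
  assumes "convex C" and "symmetric_about C x0" and X0: "X0 = span ((\<lambda>c. c - x0) ` C)"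
    and q: "q = minkowski_functional ((\<lambda>c. c - x0) ` C)"
    and "seminorm_lipschitz_on q C h" and x: "x \<in> seminorm_ball X0 q x0 1"
  obtains r L where "lipschitz_at X0 q h x r L"
proof -
  let ?D = "(\<lambda>c. c - x0) ` C"
  have sym: "?D = uminus ` ?D" and "x0 \<in> C" using assms(2) by (auto simp: symmetric_about_def)
  interpret D: convex_symmetric ?D
  proof
    show "convex ?D" using assms(1) by simp
    show "0 \<in> ?D" using \<open>x0 \<in> C\<close> by force
    show "- d \<in> ?D" if "d \<in> ?D" for d using that sym by blast
  qed
  interpret seminorm_on X0 q unfolding X0 q by (rule D.seminorm_on_axioms)
  obtain L where L: "L > 0" "\<And>y z. y \<in> C \<Longrightarrow> z \<in> C \<Longrightarrow> \<bar>h y - h z\<bar> \<le> L * q (y - z)"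
    using assms(5) by (auto simp: seminorm_lipschitz_on_def)
  have mem: "y \<in> C" if y: "y - x \<in> X0" "q (y - x) < 1 - q (x - x0)" for y
  proof -
    have eq: "y - x0 = (y - x) + (x - x0)" by simp
    have "x - x0 \<in> X0" using x by (simp add: seminorm_ball_def)
    with y have "y - x0 \<in> X0" unfolding eq by (intro subspace_add[OF subspace])
    moreover have "q (y - x0) < 1"
      unfolding eq using triangle[OF y(1) \<open>x - x0 \<in> X0\<close>] y(2) by simp
    ultimately have "y - x0 \<in> ?D" using D.minkowski_less_one X0 q by simp
    thus ?thesis by auto
  qed
  have "lipschitz_at X0 q h x (1 - q (x - x0)) L"
    by unfold_locales (use x L mem in \<open>auto simp: seminorm_ball_def\<close>)
  thus ?thesis by (rule that)
qed

theorem theorem3p4: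
  fixes Q C X0 :: "'a::real_vector set"
    and x0 x :: 'a
    and \<mu> \<nu> \<phi> f :: "'a \<Rightarrow> real"
  assumes "convex Q" and "convex C" and "Q \<inter> C \<noteq> {}"
    and "x0 \<in> Q \<inter> C" and "symmetric_about Q x0" and "symmetric_about C x0"
    and "X0 = span ((\<lambda>c. c - x0) ` C)" and "X0 = span ((\<lambda>c. c - x0) ` Q)"
    and "\<mu> = minkowski_functional ((\<lambda>c. c - x0) ` C)"
    and "\<nu> = minkowski_functional ((\<lambda>c. c - x0) ` Q)"
    and "seminorm_lipschitz_on \<mu> C \<phi>"
    and "seminorm_lipschitz_on \<nu> Q f"
    and "x \<in> seminorm_ball X0 \<mu> x0 1 \<inter> seminorm_ball X0 \<nu> x0 1"
  shows "clarke_subdifferential X0 (\<lambda>v. \<mu> v + \<nu> v) (\<lambda>y. \<phi> y * f y) x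
    \<subseteq> {\<lambda>v. f x * \<xi> v + \<phi> x * \<eta> v | \<xi> \<eta>.
         \<xi> \<in> clarke_subdifferential X0 \<mu> \<phi> x \<and> \<eta> \<in> clarke_subdifferential X0 \<nu> f x}"
proof
  fix \<zeta> assume \<zeta>: "\<zeta> \<in> clarke_subdifferential X0 (\<lambda>v. \<mu> v + \<nu> v) (\<lambda>y. \<phi> y * f y) x"
  obtain r L where \<phi>: "lipschitz_at X0 \<mu> \<phi> x r L"
    using lipschitz_at_minkowski[of C x0 X0 \<mu> \<phi> x] assms by blast
  obtain s M where f: "lipschitz_at X0 \<nu> f x s M"
    using lipschitz_at_minkowski[of Q x0 X0 \<nu> f x] assms by blast
  interpret \<phi>: lipschitz_at X0 \<mu> \<phi> x r L by (rule \<phi>)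
  interpret f: lipschitz_at X0 \<nu> f x s M by (rule f)
  note X0 = \<phi>.subspace
  have \<zeta>_add: "\<zeta> (u + v) = \<zeta> u + \<zeta> v" if "u \<in> X0" "v \<in> X0" for u v
    using \<zeta> that by (simp add: clarke_subdifferential_def algebraic_dual_def)
  have \<zeta>_scale: "\<zeta> (c *\<^sub>R v) = c * \<zeta> v" if "v \<in> X0" for c v
    using \<zeta> that by (simp add: clarke_subdifferential_def algebraic_dual_def)
  have \<zeta>_out: "\<zeta> v = 0" if "v \<notin> X0" for v
    using \<zeta> that by (simp add: clarke_subdifferential_def algebraic_dual_def)
  have \<zeta>_le: "\<zeta> v \<le> \<phi>.deriv (f x *\<^sub>R v) + f.deriv (\<phi> x *\<^sub>R v)" if v: "v \<in> X0" for v
  proof -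
    have "ereal (\<zeta> v) \<le> clarke_derivative X0 (\<lambda>v. \<mu> v + \<nu> v) (\<lambda>y. \<phi> y * f y) x v"
      using \<zeta> v by (simp add: clarke_subdifferential_def)
    also note clarke_derivative_mult_le[OF \<phi> f v]
    finally show ?thesis by simp
  qed
  \<comment> \<open>A linear projection onto \<open>X0\<close>, obtained as a left inverse of the
    identity on \<open>X0\<close>; it extends both derivatives to sublinear functions on the whole
    type.\<close>
  obtain \<pi> :: "'a \<Rightarrow> 'a" where \<pi>: "linear \<pi>" "range \<pi> \<subseteq> X0" and \<pi>_id: "\<And>v. v \<in> X0 \<Longrightarrow> \<pi> v = v"
    using linear_exists_left_inverse_on[OF linear_id X0] by auto
  define p where "p w = \<phi>.deriv (\<pi> (fst w)) + f.deriv (\<pi> (snd w))" for w :: "'a \<times> 'a"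
  \<comment> \<open>Prescribing values through a relation avoids having to show that \<zeta> v
    depends only on the pair, so the case f x = \<phi> x = 0 needs no separate treatment.\<close>
  define K where "K = (\<lambda>v. ((f x *\<^sub>R v, \<phi> x *\<^sub>R v), \<zeta> v)) ` X0"
  note sub = \<phi>.sublinear_deriv_comp[OF \<pi>] f.sublinear_deriv_comp[OF \<pi>]
  have "sublinear p"
  proof (rule sublinearI)
    show "p (u + v) \<le> p u + p v" for u v
      using sublinear_add[OF sub(1), of "fst u" "fst v"] sublinear_add[OF sub(2), of "snd u" "snd v"]
      by (simp add: p_def)
    show "p (c *\<^sub>R u) \<le> c * p u" if "c > 0" for c u
      using sublinear_scale[OF sub(1) that, of "fst u"] sublinear_scale[OF sub(2) that, of "snd u"]
      by (simp add: p_def distrib_left)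
  qed
  then obtain \<Lambda> where \<Lambda>: "linear \<Lambda>" and \<Lambda>_le: "\<And>w. \<Lambda> w \<le> p w"
    and \<Lambda>_ge: "\<And>u s. (u, s) \<in> K \<Longrightarrow> s \<le> \<Lambda> u"
  proof (rule Hahn_Banach_cone[of p K])
    show "(0, 0) \<in> K"
      unfolding K_def using subspace_0[OF X0] \<zeta>_scale[of 0 0]
      by (intro image_eqI[of _ _ 0]) (auto simp: zero_prod_def)
    show "k + l \<in> K" if "k \<in> K" "l \<in> K" for k l
    proof -
      from that obtain u v where "u \<in> X0" "v \<in> X0"
        "k = ((f x *\<^sub>R u, \<phi> x *\<^sub>R u), \<zeta> u)" "l = ((f x *\<^sub>R v, \<phi> x *\<^sub>R v), \<zeta> v)"
        by (auto simp: K_def)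
      thus ?thesis unfolding K_def using subspace_add[OF X0]
        by (intro image_eqI[of _ _ "u + v"]) (auto simp: \<zeta>_add scaleR_add_right)
    qed
    show "c *\<^sub>R k \<in> K" if "k \<in> K" for c k
    proof -
      from that obtain u where "u \<in> X0" "k = ((f x *\<^sub>R u, \<phi> x *\<^sub>R u), \<zeta> u)" by (auto simp: K_def)
      thus ?thesis unfolding K_def using subspace_scale[OF X0]
        by (intro image_eqI[of _ _ "c *\<^sub>R u"]) (auto simp: \<zeta>_scale mult.commute)
    qed
    show "s \<le> p u" if "(u, s) \<in> K" for u s
      using that \<zeta>_le by (auto simp: K_def p_def \<pi>_id subspace_scale[OF X0])
  qed blast
  have ge: "\<zeta> v \<le> \<Lambda> (f x *\<^sub>R v, \<phi> x *\<^sub>R v)" if "v \<in> X0" for v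
    unfolding K_def using that by (intro \<Lambda>_ge[unfolded K_def] imageI)
  \<comment> \<open>The constraints hold for v and for - v, which turns the lower bound into
    equality.\<close>
  have \<Lambda>_eq: "\<Lambda> (f x *\<^sub>R v, \<phi> x *\<^sub>R v) = \<zeta> v" if v: "v \<in> X0" for v
  proof (rule antisym)
    show "\<zeta> v \<le> \<Lambda> (f x *\<^sub>R v, \<phi> x *\<^sub>R v)" by (rule ge[OF v])
    have "\<zeta> (- v) \<le> \<Lambda> (f x *\<^sub>R (- v), \<phi> x *\<^sub>R (- v))"
      by (rule ge[OF subspace_neg[OF X0 v]])
    thus "\<Lambda> (f x *\<^sub>R v, \<phi> x *\<^sub>R v) \<le> \<zeta> v"
      using \<zeta>_scale[OF v, of "-1"] linear_neg[OF \<Lambda>, of "(f x *\<^sub>R v, \<phi> x *\<^sub>R v)"] by simp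
  qed
  define \<xi> where "\<xi> v = \<Lambda> (v, 0)" for v
  define \<eta> where "\<eta> v = \<Lambda> (0, v)" for v
  have "linear \<xi>"
    using linear_add[OF \<Lambda>, of "(_, 0)" "(_, 0)"] linear_scale[OF \<Lambda>, of _ "(_, 0)"]
    by (auto simp: \<xi>_def intro!: linearI)
  hence \<xi>: "(\<lambda>v. if v \<in> X0 then \<xi> v else 0) \<in> clarke_subdifferential X0 \<mu> \<phi> x"
  proof (rule clarke_subdifferentialI[OF \<phi>])
    \<comment> \<open>On the first axis the second summand of p is the derivative in direction 0,
      which is 0.\<close>
    show "\<xi> v \<le> \<phi>.deriv v" if "v \<in> X0" for v
      using \<Lambda>_le[of "(v, 0)"] that
      by (simp add: \<xi>_def p_def \<pi>_id linear_0[OF \<pi>(1)] f.deriv_zero)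
  qed
  have "linear \<eta>"
    using linear_add[OF \<Lambda>, of "(0, _)" "(0, _)"] linear_scale[OF \<Lambda>, of _ "(0, _)"]
    by (auto simp: \<eta>_def intro!: linearI)
  hence \<eta>: "(\<lambda>v. if v \<in> X0 then \<eta> v else 0) \<in> clarke_subdifferential X0 \<nu> f x"
  proof (rule clarke_subdifferentialI[OF f])
    show "\<eta> v \<le> f.deriv v" if "v \<in> X0" for v
      using \<Lambda>_le[of "(0, v)"] that
      by (simp add: \<eta>_def p_def \<pi>_id linear_0[OF \<pi>(1)] \<phi>.deriv_zero)
  qed
  \<comment> \<open>Both sides vanish outside \<open>X0\<close>, so the identity of functionals is
    an identity of functions on the whole type.\<close>
  have "\<zeta> v = f x * (if v \<in> X0 then \<xi> v else 0) + \<phi> x * (if v \<in> X0 then \<eta> v else 0)" for v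
  proof (cases "v \<in> X0")
    case True
    have "\<zeta> v = \<Lambda> (f x *\<^sub>R (v, 0) + \<phi> x *\<^sub>R (0, v))" using \<Lambda>_eq[OF True] by simp
    thus ?thesis
      using True linear_add[OF \<Lambda>, of "f x *\<^sub>R (v, 0)" "\<phi> x *\<^sub>R (0, v)"]
        linear_scale[OF \<Lambda>, of "f x" "(v, 0)"] linear_scale[OF \<Lambda>, of "\<phi> x" "(0, v)"]
      by (simp add: \<xi>_def \<eta>_def)
  qed (simp add: \<zeta>_out)
  hence "\<zeta> = (\<lambda>v. f x * (if v \<in> X0 then \<xi> v else 0) + \<phi> x * (if v \<in> X0 then \<eta> v else 0))"
    by (rule ext)
  with \<xi> \<eta> show "\<zeta> \<in> {\<lambda>v. f x * \<xi> v + \<phi> x * \<eta> v | \<xi> \<eta>.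
      \<xi> \<in> clarke_subdifferential X0 \<mu> \<phi> x \<and> \<eta> \<in> clarke_subdifferential X0 \<nu> f x}"
    by (intro CollectI exI conjI) assumption+
qed

end
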